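(* Let $n$ be a positive integer, and let $a$ and $r$ be non-negative integers with $a\leqslant n$. Then, for every integer $j$ with $0\leqslant j\leqslant 2r+1$, $$ \sum_{k=a}^{n} A_{n,k}(q)^{2r+1} q^{j(k^2+k)} \equiv 0\pmod{{2n\brack n-a}}. $$
   Context: $q$ is an indeterminate. The $q$-integers are $[n]=\frac{1-q^n}{1-q}$, and $(q;q)_n=(1-q)(1-q^2)\cdots(1-q^n)$, $(q;q)_0=1$. The $q$-binomial coefficient is ${n\brack k}=\frac{(q;q)_n}{(q;q)_k(q;q)_{n-k}}$ if $0\leqslant k\leqslant n$ and $0$ otherwise. For $0\leqslant k\leqslant n$, $A_{n,k}(q)=q^{n-k}\frac{[2k+1]}{[2n+1]}{2n+1\brack n-k}={2n\brack n-k}-{2n\brack n-k-1}$. For a Laurent polynomial $P(q)$ and a polynomial $D(q)$, $P(q)\equiv 0\pmod{D(q)}$ means that $P(q)/D(q)$ is a Laurent polynomial in $q$. *)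

theory Defs
  imports "HOL-Computational_Algebra.Computational_Algebra"
begin

text \<open>
  All expressions live in the fraction field of \<open>\<int>[q]\<close>, so that the
  quotients below are literal quotients of elements of a field.
\<close>

definition q :: "int poly fract" where
  "q = to_fract [:0, 1:]"

definition qint :: "nat \<Rightarrow> int poly fract" where
  "qint n = (1 - q ^ n) / (1 - q)"

definition qpoch :: "nat \<Rightarrow> int poly fract" where
  "qpoch n = (\<Prod>i = 1..n. 1 - q ^ i)"

definition qbinom :: "nat \<Rightarrow> nat \<Rightarrow> int poly fract" where
  "qbinom n k = (if k \<le> n then qpoch n / (qpoch k * qpoch (n - k)) else 0)"

text \<open>Only meaningful for \<open>k \<le> n\<close>; for larger \<open>k\<close> the subtraction \<open>n - k\<close> truncates.\<close>

definition A :: "nat \<Rightarrow> nat \<Rightarrow> int poly fract" where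
  "A n k = q ^ (n - k) * (qint (2 * k + 1) / qint (2 * n + 1)) * qbinom (2 * n + 1) (n - k)"

text \<open>
  Laurent polynomials have integer coefficients. Rational coefficients would give an equivalent
  congruence, as \<open>q\<close>-binomial coefficients are monic polynomials over \<open>\<int>\<close>.
\<close>

definition is_laurent_poly :: "int poly fract \<Rightarrow> bool" where
  "is_laurent_poly x \<longleftrightarrow> (\<exists>(p :: int poly) (m :: nat). x = to_fract p / q ^ m)"

text \<open>
  \<open>P \<equiv> 0 (mod D)\<close>. As division by \<open>0\<close> yields \<open>0\<close>, this is meaningful only for \<open>D \<noteq> 0\<close>;
  \<open>qbinom_nonzero\<close> below provides this for the moduli of interest.
\<close>

definition laurent_cong_0 :: "int poly fract \<Rightarrow> int poly fract \<Rightarrow> bool" where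
  "laurent_cong_0 P D \<longleftrightarrow> is_laurent_poly (P / D)"

lemma q_power: "q ^ n = to_fract (monom 1 n)"
proof (induction n)
  case (Suc n)
  have "monom 1 (Suc n) = [:0, 1:] * (monom 1 n :: int poly)"
    by (simp add: monom_Suc)
  with Suc show ?case by (simp add: q_def del: mult_pCons_left)
qed simp

lemma one_minus_q_power_nonzero:
  assumes "n > 0" shows "1 - q ^ n \<noteq> 0"
proof
  assume "1 - q ^ n = 0"
  then have "to_fract (monom 1 n :: int poly) = to_fract (monom 1 0)"
    by (simp add: q_power)
  then have "(monom 1 n :: int poly) = monom 1 0"
    by (simp only: to_fract_eq_iff)
  then show False using assms by (metis degree_monom_eq less_irrefl zero_neq_one)
qed

lemma qpoch_nonzero: "qpoch n \<noteq> 0"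
  using one_minus_q_power_nonzero by (auto simp: qpoch_def)

lemma qbinom_nonzero: "k \<le> n \<Longrightarrow> qbinom n k \<noteq> 0"
  by (simp add: qbinom_def qpoch_nonzero)

lemma qpoch_Suc: "qpoch (Suc n) = qpoch n * (1 - q ^ Suc n)"
  by (simp add: qpoch_def)

text \<open>
  The second expression for \<open>A\<^sub>n\<^sub>,\<^sub>k(q)\<close>. In the case \<open>k = n\<close> the lower index of the
  subtrahend would be \<open>-1\<close>, so that the subtrahend vanishes.
\<close>

lemma A_eq_diff:
  assumes "k \<le> n"
  shows "A n k = qbinom (2 * n) (n - k) - (if k < n then qbinom (2 * n) (n - k - 1) else 0)"
proof (cases "k = n")
  case True
  then show ?thesis
    using one_minus_q_power_nonzero[of "Suc (2 * n)"] one_minus_q_power_nonzero[of 1]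
    by (simp add: A_def qbinom_def qpoch_nonzero qint_def qpoch_def)
next
  case False
  with assms obtain m where n: "n = k + Suc m" by (metis less_imp_Suc_add le_neq_implies_less add_Suc_right)
  define x where "x = q ^ Suc m"
  define y where "y = q ^ Suc (n + k)"
  define z where "z = q ^ Suc (2 * n)"
  define w where "w = q ^ (2 * k + 1)"
  define F where "F = qpoch (2 * n)"
  define G where "G = qpoch m"
  define H where "H = qpoch (n + k)"
  have nz: "1 - q \<noteq> 0" "1 - x \<noteq> 0" "1 - y \<noteq> 0" "1 - z \<noteq> 0" "F \<noteq> 0" "G \<noteq> 0" "H \<noteq> 0"
    using one_minus_q_power_nonzero[of 1] one_minus_q_power_nonzero[of "Suc m"]
      one_minus_q_power_nonzero[of "Suc (n + k)"] one_minus_q_power_nonzero[of "Suc (2 * n)"]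
    by (simp_all only: x_def y_def z_def F_def G_def H_def qpoch_nonzero) auto
  have e: "qpoch (Suc m) = G * (1 - x)" "qpoch (Suc (n + k)) = H * (1 - y)"
    "qpoch (Suc (2 * n)) = F * (1 - z)"
    by (simp_all only: qpoch_Suc x_def y_def z_def F_def G_def H_def)
  have "Suc (n + k) = Suc m + (2 * k + 1)" using n by simp
  then have yx: "y = x * w"
    by (simp only: x_def y_def w_def power_add[symmetric])
  have i: "n - k = Suc m" "n - k - 1 = m" "2 * n + 1 = Suc (2 * n)" "2 * n + 1 - Suc m = Suc (n + k)"
    "2 * n - Suc m = n + k" "2 * n - m = Suc (n + k)" "Suc m \<le> 2 * n" "m \<le> 2 * n" 
    "Suc m \<le> Suc (2 * n)" "k < n" using n by auto
  have "A n k = x * ((1 - w) / (1 - q) / ((1 - z) / (1 - q))) * (F * (1 - z) / (G * (1 - x) * (H * (1 - y))))"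
    using i e by (simp add: A_def qint_def qbinom_def x_def w_def z_def)
  also have "\<dots> = x * (1 - w) * F / (G * (1 - x) * (H * (1 - y)))"
    using nz by simp
  also have "x * (1 - w) = (1 - y) - (1 - x)" by (simp add: yx algebra_simps)
  also have "((1 - y) - (1 - x)) * F / (G * (1 - x) * (H * (1 - y)))
      = F / (G * (1 - x) * H) - F / (G * (H * (1 - y)))"
  proof -
    have "(Y - X) * F / (G * X * (H * Y)) = F / (G * X * H) - F / (G * (H * Y))"
      if "X \<noteq> 0" "Y \<noteq> 0" for X Y
      using that nz(6,7) by (simp add: field_simps)
    with nz(2,3) show ?thesis by blast
  qed
  also have "\<dots> = qbinom (2 * n) (n - k) - qbinom (2 * n) (n - k - 1)"
    using i e by (simp add: qbinom_def F_def G_def H_def)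
  finally show ?thesis using i by simp
qed

end

theory Submission
  imports Defs
begin

text \<open>
  Put \<open>m = n - k\<close>, \<open>M = n + k + 1\<close>, \<open>N = m + M = 2 n + 1\<close>, and let \<open>e\<^sub>u\<close> be the product of the
  \<open>q\<close>-binomial coefficients of \<open>m\<close> over \<open>u\<close> and of \<open>M\<close> over \<open>u\<close>, as a function of \<open>k\<close>. The sum of
  \<open>A\<^sub>n\<^sub>,\<^sub>k e\<^sub>u(k)\<close> over \<open>k \<ge> a\<close>, possibly weighted by \<open>q\<close> to the power \<open>k\<^sup>2 + k\<close>, telescopes to a
  multiple of the modulus. Hence it suffices that \<open>A\<^sub>n\<^sub>,\<^sub>k\<^sup>2\<close>, weighted by \<open>q\<close> to the power
  \<open>e (k\<^sup>2 + k)\<close> with \<open>e \<le> 2\<close>, maps the Laurent span of the \<open>e\<^sub>u\<close> to itself. With \<open>B\<close> the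
  \<open>q\<close>-binomial coefficient of \<open>N\<close> over \<open>m\<close>, \<open>Y = (1 - q\<^sup>m) (1 - q\<^sup>M)\<close> and \<open>z = q\<^sup>N\<close>, one has
  \<open>A\<^sub>n\<^sub>,\<^sub>k\<^sup>2 = B\<^sup>2 + (B / (1 - z)) (Y B / (1 - z)) (Y - 2 (1 + z))\<close>, and the \<open>q\<close>-Vandermonde identity, whose
  two forms account for the weights, expands \<open>B e\<^sub>i\<close> and \<open>Y B e\<^sub>i / (1 - z)\<close> in the \<open>e\<^sub>u\<close>.
  The latter expansion has coefficients divisible by \<open>1 - q\<^sup>u\<close>, which pays for the remaining
  denominator \<open>1 - z\<close>.
\<close>

section \<open>Laurent polynomials as a subring of the fraction field\<close>

lemma q_nonzero [simp]: "q \<noteq> 0"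
  using one_minus_q_power_nonzero[of 1] q_power[of 1] by (auto simp: q_def)

lemma laurent_q_power [simp]: "is_laurent_poly (q ^ i)"
  unfolding is_laurent_poly_def by (rule exI[of _ "monom 1 i"], rule exI[of _ 0]) (simp add: q_power)

lemma laurent_1 [simp]: "is_laurent_poly 1"
  using laurent_q_power[of 0] by simp

lemma laurent_0 [simp]: "is_laurent_poly 0"
  unfolding is_laurent_poly_def by (rule exI[of _ 0]) simp

lemma laurent_add:
  assumes "is_laurent_poly x" "is_laurent_poly y"
  shows "is_laurent_poly (x + y)"
proof -
  obtain p i s j where "x = to_fract p / q ^ i" "y = to_fract s / q ^ j"
    using assms unfolding is_laurent_poly_def by blast
  then have "x + y = to_fract (p * monom 1 j + s * monom 1 i) / q ^ (i + j)"
    by (simp add: to_fract_add to_fract_mult q_power[symmetric] power_add add_frac_eq mult.commute)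
  then show ?thesis unfolding is_laurent_poly_def by blast
qed

lemma laurent_mult:
  assumes "is_laurent_poly x" "is_laurent_poly y"
  shows "is_laurent_poly (x * y)"
proof -
  obtain p i s j where "x = to_fract p / q ^ i" "y = to_fract s / q ^ j"
    using assms unfolding is_laurent_poly_def by blast
  then have "x * y = to_fract (p * s) / q ^ (i + j)"
    by (simp add: to_fract_mult power_add)
  then show ?thesis unfolding is_laurent_poly_def by blast
qed

lemma laurent_minus: "is_laurent_poly x \<Longrightarrow> is_laurent_poly (- x)"
  unfolding is_laurent_poly_def
  by (metis minus_divide_left to_fract_uminus)

lemma laurent_diff: "is_laurent_poly x \<Longrightarrow> is_laurent_poly y \<Longrightarrow> is_laurent_poly (x - y)"
  using laurent_add[OF _ laurent_minus, of x y] by simp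

lemma laurent_divide_q_power: "is_laurent_poly x \<Longrightarrow> is_laurent_poly (x / q ^ i)"
  unfolding is_laurent_poly_def by (metis divide_divide_eq_left power_add)

lemma laurent_power: "is_laurent_poly x \<Longrightarrow> is_laurent_poly (x ^ i)"
  by (induction i) (auto intro: laurent_mult)

lemma laurent_sum: "(\<And>i. i \<in> I \<Longrightarrow> is_laurent_poly (f i)) \<Longrightarrow> is_laurent_poly (sum f I)"
  by (induction I rule: infinite_finite_induct) (auto intro: laurent_add)

section \<open>Identities for \<open>q\<close>-binomial coefficients, up to
  \<open>q\<close>-Vandermonde\<close>

lemma qpoch_0 [simp]: "qpoch 0 = 1"
  by (simp add: qpoch_def)

lemma qbinom_0 [simp]: "qbinom n 0 = 1"
  by (simp add: qbinom_def qpoch_nonzero)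

lemma qbinom_same [simp]: "qbinom n n = 1"
  by (simp add: qbinom_def qpoch_nonzero)

lemma qbinom_eq_0 [simp]: "n < k \<Longrightarrow> qbinom n k = 0"
  by (simp add: qbinom_def)

lemma qbinom_add: "qbinom (i + j) i = qpoch (i + j) / (qpoch i * qpoch j)"
  by (simp add: qbinom_def)

lemma qbinom_Suc_Suc: "qbinom (Suc n) (Suc k) = qbinom n (Suc k) + q ^ (n - k) * qbinom n k"
proof (cases "k < n")
  case True
  then obtain j where n: "n = k + Suc j" using less_iff_Suc_add by auto
  define x y where "x = q ^ Suc k" and "y = q ^ Suc j"
  have nz: "1 - x \<noteq> 0" "1 - y \<noteq> 0"
    unfolding x_def y_def by (rule one_minus_q_power_nonzero; simp)+
  have s: "Suc n = Suc k + Suc j" "n = Suc k + j" "n = k + Suc j" "n - k = Suc j" using n by auto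
  have "q ^ Suc n = x * y" unfolding x_def y_def power_add[symmetric] s(1) ..
  then have 1: "qbinom (Suc n) (Suc k) = qpoch n * (1 - x * y) / (qpoch k * (1 - x) * (qpoch j * (1 - y)))"
    using qbinom_add[of "Suc k" "Suc j"] unfolding s(1)[symmetric] by (simp only: qpoch_Suc x_def y_def)
  have 2: "qbinom n (Suc k) = qpoch n / (qpoch k * (1 - x) * qpoch j)"
    using qbinom_add[of "Suc k" j] unfolding s(2)[symmetric] by (simp only: qpoch_Suc x_def)
  have 3: "qbinom n k = qpoch n / (qpoch k * (qpoch j * (1 - y)))"
    using qbinom_add[of k "Suc j"] unfolding s(3)[symmetric] by (simp only: qpoch_Suc y_def)
  have 4: "q ^ (n - k) = y" unfolding s(4) y_def ..
  show ?thesis unfolding 1 2 3 4 using nz qpoch_nonzero[of k] qpoch_nonzero[of j]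
    by (simp add: divide_simps) (simp add: algebra_simps)
next
  case False
  then show ?thesis by (cases "k = n") auto
qed

text \<open>The quotient of products in \<open>qbinom\<close> does not show integrality; the
  \<open>q\<close>-Pascal rule \<open>qbinom_Suc_Suc\<close> gives it by induction.\<close>

lemma laurent_qbinom [simp]: "is_laurent_poly (qbinom n k)"
proof (induction n arbitrary: k)
  case 0
  then show ?case by (cases k) auto
next
  case (Suc n)
  then show ?case by (cases k) (auto simp: qbinom_Suc_Suc intro!: laurent_add laurent_mult)
qed

lemma qbinom_absorb: "(1 - q ^ Suc n) * qbinom n k = (1 - q ^ Suc k) * qbinom (Suc n) (Suc k)"
proof (cases "k \<le> n")
  case True
  then show ?thesis
    using one_minus_q_power_nonzero[of "Suc k"] qpoch_nonzero[of k] qpoch_nonzero[of "n - k"]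
    by (simp add: qbinom_def qpoch_Suc divide_simps del: power_Suc)
qed simp

text \<open>For \<open>i \<le> u\<close> both sides are the \<open>q\<close>-multinomial coefficient
  with parts \<open>i\<close>, \<open>u - i\<close> and \<open>m - u\<close>; for
  \<open>i > u\<close> both vanish.\<close>

lemma qbinom_trinomial:
  assumes "i \<le> m" "u \<le> m"
  shows "qbinom m u * qbinom u i = qbinom m i * qbinom (m - i) (m - u)"
proof (cases "i \<le> u")
  case True
  then have "m - i - (m - u) = u - i" "m - u \<le> m - i" using assms by auto
  then show ?thesis using True assms by (simp add: qbinom_def qpoch_nonzero)
qed (use assms in auto)

lemma qbinom_trinomial': "qbinom (m + M) m * qbinom M i = qbinom (m + M) i * qbinom (m + M - i) m"
proof (cases "i \<le> M")
  case True
  then have "m + M - i - m = M - i" "m \<le> m + M - i" "i \<le> m + M" by auto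
  then show ?thesis using True by (simp add: qbinom_def qpoch_nonzero)
next
  case False
  then show ?thesis by (cases "m + M < i") (auto intro!: qbinom_eq_0)
qed

text \<open>By induction on \<open>x\<close>, the \<open>q\<close>-Pascal rule splits the sum for
  \<open>Suc x\<close> and \<open>t\<close> into the sums for \<open>x\<close> with \<open>t\<close>
  and with \<open>t - 1\<close>. Where \<open>y - u\<close> truncates, \<open>qbinom y u\<close> is
  zero.\<close>

lemma q_Vandermonde:
  "qbinom (x + y) t = (\<Sum>u\<le>t. qbinom x (t - u) * qbinom y u * q ^ ((t - u) * (y - u)))"
proof (induction x arbitrary: t)
  case 0
  have "(\<Sum>u\<le>t. qbinom 0 (t - u) * qbinom y u * q ^ ((t - u) * (y - u)))
      = (\<Sum>u\<le>t. if u = t then qbinom y t else 0)"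
    by (rule sum.cong) auto
  then show ?case by simp
next
  case (Suc x)
  show ?case
  proof (cases t)
    case 0
    then show ?thesis by simp
  next
    case (Suc s)
    have "(\<Sum>u\<le>t. qbinom (Suc x) (t - u) * qbinom y u * q ^ ((t - u) * (y - u)))
        = qbinom y t + (\<Sum>u\<le>s. qbinom (Suc x) (Suc (s - u)) * qbinom y u * q ^ (Suc (s - u) * (y - u)))"
      by (simp add: Suc Suc_diff_le)
    also have "(\<Sum>u\<le>s. qbinom (Suc x) (Suc (s - u)) * qbinom y u * q ^ (Suc (s - u) * (y - u)))
       = (\<Sum>u\<le>s. qbinom x (Suc (s - u)) * qbinom y u * q ^ (Suc (s - u) * (y - u))
            + q ^ (x + y - s) * (qbinom x (s - u) * qbinom y u * q ^ ((s - u) * (y - u))))"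
    proof (rule sum.cong)
      fix u assume "u \<in> {..s}"
      then have u: "u \<le> s" by simp
      \<comment> \<open>The exponents agree only while no subtraction truncates. Otherwise
        \<open>qbinom x (s - u)\<close> or \<open>qbinom y u\<close> is zero.\<close>
      have "q ^ (x - (s - u)) * q ^ (Suc (s - u) * (y - u)) = q ^ (x + y - s) * q ^ ((s - u) * (y - u))"
        if "s - u \<le> x" "u \<le> y"
      proof -
        have "x - (s - u) + Suc (s - u) * (y - u) = x + y - s + (s - u) * (y - u)"
          using that u by simp
        then show ?thesis by (simp only: power_add[symmetric])
      qed
      then have "q ^ (x - (s - u)) * qbinom x (s - u) * qbinom y u * q ^ (Suc (s - u) * (y - u))
         = q ^ (x + y - s) * (qbinom x (s - u) * qbinom y u * q ^ ((s - u) * (y - u)))"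
        by (cases "s - u \<le> x"; cases "u \<le> y") (simp_all add: algebra_simps)
      then show "qbinom (Suc x) (Suc (s - u)) * qbinom y u * q ^ (Suc (s - u) * (y - u))
          = qbinom x (Suc (s - u)) * qbinom y u * q ^ (Suc (s - u) * (y - u))
            + q ^ (x + y - s) * (qbinom x (s - u) * qbinom y u * q ^ ((s - u) * (y - u)))"
        unfolding qbinom_Suc_Suc distrib_right by simp
    qed simp
    also have "\<dots> = (\<Sum>u\<le>s. qbinom x (Suc (s - u)) * qbinom y u * q ^ (Suc (s - u) * (y - u)))
         + q ^ (x + y - s) * qbinom (x + y) s"
      by (simp add: sum.distrib sum_distrib_left Suc.IH)
    also have "qbinom y t + \<dots> = qbinom (x + y) t + q ^ (x + y - s) * qbinom (x + y) s"
      unfolding Suc.IH[of t] by (simp add: Suc Suc_diff_le)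
    also have "\<dots> = qbinom (Suc x + y) t" by (simp add: Suc qbinom_Suc_Suc)
    finally show ?thesis ..
  qed
qed

text \<open>Exchange \<open>x\<close> and \<open>y\<close> and reverse the sum. With
  \<open>x = n - k - i\<close> and \<open>t = n - k\<close> the exponent becomes
  \<open>u * (u - i)\<close>, free of \<open>k\<close>; the first form has this property only after
  multiplication by q^(k^2+k).\<close>

lemma q_Vandermonde':
  "qbinom (x + y) t = (\<Sum>u\<le>t. qbinom x (t - u) * qbinom y u * q ^ (u * (x - (t - u))))"
proof -
  have "(\<Sum>u\<le>t. qbinom x (t - u) * qbinom y u * q ^ (u * (x - (t - u))))
      = (\<Sum>u\<le>t. qbinom y (t - u) * qbinom x u * q ^ ((t - u) * (x - u)))"
    by (rule sum.reindex_bij_witness[of _ "\<lambda>u. t - u" "\<lambda>u. t - u"]) auto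
  then show ?thesis using q_Vandermonde[of y x t] by (simp add: add.commute)
qed

section \<open>The Newton basis and its Laurent span\<close>

text \<open>For \<open>u \<le> n\<close> this is, up to a factor free of \<open>k\<close>, the
  Newton interpolation polynomial of degree \<open>u\<close> in q^(n-k) + q^(n+k+1) with zeros at k
  = n, n-1, ..., n-u+1.\<close>

definition newton_basis :: "nat \<Rightarrow> nat \<Rightarrow> nat \<Rightarrow> int poly fract" where
  "newton_basis n u k = qbinom (n - k) u * qbinom (n + k + 1) u"

text \<open>
  Only the values of \<open>f\<close> on \<open>{0..n}\<close> matter. The factors \<open>c u\<close> are used with \<open>c u = 1\<close> and
  \<open>c u = 1 - q ^ u\<close>.
\<close>

definition newton_span :: "nat \<Rightarrow> (nat \<Rightarrow> int poly fract) \<Rightarrow> (nat \<Rightarrow> int poly fract) set" where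
  "newton_span n c = {f. \<exists>d. (\<forall>u. is_laurent_poly (d u)) \<and>
      (\<forall>k\<le>n. f k = (\<Sum>u\<le>n. d u * (c u * newton_basis n u k)))}"

lemma newton_spanI:
  assumes "\<And>u. is_laurent_poly (d u)"
    and "\<And>k. k \<le> n \<Longrightarrow> f k = (\<Sum>u\<le>n. d u * (c u * newton_basis n u k))"
  shows "f \<in> newton_span n c"
  using assms unfolding newton_span_def by blast

lemma newton_span_add:
  assumes "f \<in> newton_span n c" "g \<in> newton_span n c"
  shows "(\<lambda>k. f k + g k) \<in> newton_span n c"
proof -
  obtain d d' where "\<forall>u. is_laurent_poly (d u)" "\<forall>u. is_laurent_poly (d' u)"
    "\<forall>k\<le>n. f k = (\<Sum>u\<le>n. d u * (c u * newton_basis n u k))"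
    "\<forall>k\<le>n. g k = (\<Sum>u\<le>n. d' u * (c u * newton_basis n u k))"
    using assms unfolding newton_span_def by blast
  then show ?thesis
    by (intro newton_spanI[of "\<lambda>u. d u + d' u"]) (auto simp: distrib_right sum.distrib intro: laurent_add)
qed

lemma newton_span_scale:
  assumes "is_laurent_poly x" "f \<in> newton_span n c"
  shows "(\<lambda>k. x * f k) \<in> newton_span n c"
proof -
  obtain d where "\<forall>u. is_laurent_poly (d u)"
    "\<forall>k\<le>n. f k = (\<Sum>u\<le>n. d u * (c u * newton_basis n u k))"
    using assms unfolding newton_span_def by blast
  then show ?thesis using assms(1)
    by (intro newton_spanI[of "\<lambda>u. x * d u"]) (auto simp: sum_distrib_left mult.assoc intro: laurent_mult)
qed

lemma newton_span_sum:
  assumes "\<And>i. i \<in> I \<Longrightarrow> f i \<in> newton_span n c"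
  shows "(\<lambda>k. \<Sum>i\<in>I. f i k) \<in> newton_span n c"
proof -
  have "(\<lambda>k. 0) \<in> newton_span n c" by (rule newton_spanI[of "\<lambda>u. 0"]) auto
  with assms show ?thesis
    by (induction I rule: infinite_finite_induct) (auto intro: newton_span_add)
qed

lemma newton_span_cong:
  assumes "f \<in> newton_span n c" "\<And>k. k \<le> n \<Longrightarrow> f k = g k"
  shows "g \<in> newton_span n c"
  using assms unfolding newton_span_def by auto

lemma newton_span_mult:
  assumes "f \<in> newton_span n c"
    and "\<And>i. i \<le> n \<Longrightarrow> (\<lambda>k. g k * (c i * newton_basis n i k)) \<in> newton_span n c'"
  shows "(\<lambda>k. g k * f k) \<in> newton_span n c'"
proof -
  obtain d where d: "\<forall>u. is_laurent_poly (d u)"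
    "\<forall>k\<le>n. f k = (\<Sum>u\<le>n. d u * (c u * newton_basis n u k))"
    using assms(1) unfolding newton_span_def by blast
  have "(\<lambda>k. \<Sum>u\<le>n. d u * (g k * (c u * newton_basis n u k))) \<in> newton_span n c'"
    using d assms(2) by (auto intro!: newton_span_sum newton_span_scale)
  then show ?thesis
    by (rule newton_span_cong) (use d in \<open>simp add: sum_distrib_left mult_ac\<close>)
qed


section \<open>Expanding products of \<open>q\<close>-binomial coefficients with basis
  elements\<close>

lemma newton_basis_eq_0: "n - k < u \<Longrightarrow> newton_basis n u k = 0"
  by (simp add: newton_basis_def)

text \<open>Trinomial revision on both sides leaves a Vandermonde sum with weights \<open>w\<close>,
  which the hypothesis evaluates. With m = n-k and M = n+k+1 the outer factor
  \<open>qbinom (m + M) i\<close> depends on \<open>n\<close> and \<open>i\<close> only, so it can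
  serve as a coefficient.\<close>

lemma newton_basis_mult_qbinom:
  assumes "(\<Sum>u\<le>m. qbinom (m - i) (m - u) * qbinom M u * w u) = h * qbinom (m - i + M) m" "i \<le> m"
  shows "qbinom (m + M) m * h * (qbinom m i * qbinom M i)
    = qbinom (m + M) i * (\<Sum>u\<le>m. qbinom u i * w u * (qbinom m u * qbinom M u))"
proof -
  have "(\<Sum>u\<le>m. qbinom u i * w u * (qbinom m u * qbinom M u))
      = (\<Sum>u\<le>m. (qbinom m u * qbinom u i) * (qbinom M u * w u))"
    by (simp add: mult_ac)
  also have "\<dots> = (\<Sum>u\<le>m. qbinom m i * (qbinom (m - i) (m - u) * qbinom M u * w u))"
  proof (rule sum.cong)
    fix u assume "u \<in> {..m}"
    then have "qbinom m u * qbinom u i = qbinom m i * qbinom (m - i) (m - u)"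
      using assms(2) by (simp add: qbinom_trinomial)
    then show "(qbinom m u * qbinom u i) * (qbinom M u * w u)
        = qbinom m i * (qbinom (m - i) (m - u) * qbinom M u * w u)" by (simp only: mult_ac)
  qed simp
  also have "\<dots> = qbinom m i * h * qbinom (m + M - i) m"
    using assms by (simp add: sum_distrib_left[symmetric])
  also have "qbinom (m + M) i * \<dots> = qbinom m i * h * (qbinom (m + M) m * qbinom M i)"
    using qbinom_trinomial'[of m M i] by (simp add: mult_ac)
  finally show ?thesis by (simp add: mult_ac)
qed

text \<open>Here \<open>Suc m\<close> and \<open>Suc M\<close> play the roles of n-k and n+k+1. The
  factor \<open>1 - q ^ u\<close> is absorbed by lowering \<open>qbinom (Suc M) u\<close> to
  \<open>qbinom M (u - 1)\<close>, which again leaves a Vandermonde sum.\<close>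

lemma newton_basis_mult_qbinom':
  assumes "(\<Sum>v\<le>m. qbinom (Suc m - i) (m - v) * qbinom M v * w (Suc v)) = h * qbinom (Suc m - i + M) m"
    and "i \<le> Suc m"
  shows "(1 - q ^ Suc M) * qbinom (m + Suc M) m * h * (qbinom (Suc m) i * qbinom (Suc M) i)
    = qbinom (m + Suc M) i *
      (\<Sum>u\<le>Suc m. qbinom u i * w u * ((1 - q ^ u) * (qbinom (Suc m) u * qbinom (Suc M) u)))"
proof -
  \<comment> \<open>The term \<open>u = 0\<close> drops out because \<open>1 - q ^ 0 = 0\<close>;
    the others are indexed by \<open>u = Suc v\<close>.\<close>
  have "(\<Sum>u\<le>Suc m. qbinom u i * w u * ((1 - q ^ u) * (qbinom (Suc m) u * qbinom (Suc M) u)))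
      = (\<Sum>v\<le>m. (qbinom (Suc m) (Suc v) * qbinom (Suc v) i) * w (Suc v) * ((1 - q ^ Suc v) * qbinom (Suc M) (Suc v)))"
    by (subst sum.atMost_Suc_shift) (simp add: mult_ac del: power_Suc)
  also have "\<dots> = (\<Sum>v\<le>m. (qbinom (Suc m) i * (1 - q ^ Suc M)) *
         (qbinom (Suc m - i) (m - v) * qbinom M v * w (Suc v)))"
  proof (rule sum.cong)
    fix v assume "v \<in> {..m}"
    then have "qbinom (Suc m) (Suc v) * qbinom (Suc v) i = qbinom (Suc m) i * qbinom (Suc m - i) (m - v)"
      using assms(2) by (subst qbinom_trinomial) auto
    then show "(qbinom (Suc m) (Suc v) * qbinom (Suc v) i) * w (Suc v) * ((1 - q ^ Suc v) * qbinom (Suc M) (Suc v))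
        = (qbinom (Suc m) i * (1 - q ^ Suc M)) * (qbinom (Suc m - i) (m - v) * qbinom M v * w (Suc v))"
      unfolding qbinom_absorb[symmetric] by (simp only: mult_ac)
  qed simp
  also have "\<dots> = qbinom (Suc m) i * (1 - q ^ Suc M) * h * qbinom (m + Suc M - i) m"
    using assms by (simp add: sum_distrib_left[symmetric] mult.assoc Suc_diff_le del: power_Suc)
  also have "qbinom (m + Suc M) i * \<dots>
      = qbinom (Suc m) i * (1 - q ^ Suc M) * h * (qbinom (m + Suc M) m * qbinom (Suc M) i)"
    using qbinom_trinomial'[of m "Suc M" i] by (simp add: mult_ac del: power_Suc)
  finally show ?thesis by (simp only: mult_ac)
qed

text \<open>With m = n-k and M = n+k+1 one has mM = n^2+n-(k^2+k) and m+M = 2n+1. Hence (m-u)(M-u) +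
  k^2+k = n^2+n+u^2-u(2n+1), which is free of \<open>k\<close>.\<close>

lemma q_power_weight:
  assumes "k \<le> n" "u \<le> n - k"
  shows "q ^ (n\<^sup>2 + n + u\<^sup>2) / q ^ (u * (2 * n + 1)) = q ^ (k\<^sup>2 + k) * q ^ ((n - k - u) * (n + k + 1 - u))"
proof -
  obtain p where n: "n = k + u + p"
    using assms by (metis add.assoc add.commute le_Suc_ex le_diff_conv2 add_le_cancel_left le_add_diff_inverse)
  have "n - k - u = p" "n + k + 1 - u = 2 * k + p + 1" using n by auto
  then have "n\<^sup>2 + n + u\<^sup>2 = (k\<^sup>2 + k) + (n - k - u) * (n + k + 1 - u) + u * (2 * n + 1)"
    using n by (simp add: power2_eq_square algebra_simps)
  then show ?thesis by (simp only: power_add) simp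
qed

text \<open>The point is that \<open>w\<close> is chosen before \<open>k\<close>, so that it yields
  coefficients for \<open>newton_span\<close>. The case \<open>\<epsilon> = 0\<close> uses
  \<open>q_Vandermonde'\<close>; the case \<open>\<epsilon> = 1\<close> uses
  \<open>q_Vandermonde\<close> and \<open>q_power_weight\<close>.\<close>

lemma weighted_q_Vandermonde:
  assumes "\<epsilon> \<le> 1"
  obtains w where "\<And>u. is_laurent_poly (w u)"
    "\<And>k. k \<le> n \<Longrightarrow> i \<le> n - k \<Longrightarrow>
      (\<Sum>u\<le>n - k. qbinom (n - k - i) (n - k - u) * qbinom (n + k + 1) u * w u)
        = q ^ (\<epsilon> * (k\<^sup>2 + k)) * qbinom (n - k - i + (n + k + 1)) (n - k)"
proof (cases "\<epsilon> = 0")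
  case True
  show ?thesis
  proof (rule that[of "\<lambda>u. q ^ (u * (u - i))"])
    fix k assume "k \<le> n" "i \<le> n - k"
    then show "(\<Sum>u\<le>n - k. qbinom (n - k - i) (n - k - u) * qbinom (n + k + 1) u * q ^ (u * (u - i)))
        = q ^ (\<epsilon> * (k\<^sup>2 + k)) * qbinom (n - k - i + (n + k + 1)) (n - k)"
      unfolding q_Vandermonde'[of "n - k - i" "n + k + 1" "n - k"] True
      by (auto intro!: sum.cong)
  qed simp
next
  case False
  then have e: "\<epsilon> = 1" using assms by simp
  show ?thesis
  proof (rule that[of "\<lambda>u. q ^ (n\<^sup>2 + n + u\<^sup>2) / q ^ (u * (2 * n + 1))"])
    fix k assume "k \<le> n" "i \<le> n - k"
    note * = q_power_weight[OF \<open>k \<le> n\<close>]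
    show "(\<Sum>u\<le>n - k. qbinom (n - k - i) (n - k - u) * qbinom (n + k + 1) u *
          (q ^ (n\<^sup>2 + n + u\<^sup>2) / q ^ (u * (2 * n + 1))))
        = q ^ (\<epsilon> * (k\<^sup>2 + k)) * qbinom (n - k - i + (n + k + 1)) (n - k)"
      unfolding q_Vandermonde[of "n - k - i" "n + k + 1" "n - k"] e sum_distrib_left
      by (rule sum.cong[OF refl]) (simp only: * atMost_iff, simp only: mult_ac mult_1)
  qed (intro laurent_divide_q_power laurent_q_power)
qed

text \<open>The same argument with m = n-k-1 and u = v+1. Since (m-v)(n+k-v) = (n-k-u)(n+k+1-u), the
  weight for \<open>\<epsilon> = 1\<close> is unchanged; for \<open>\<epsilon> = 0\<close> the
  exponent v(v+1-i) becomes (u-1)(u-i).\<close>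

lemma weighted_q_Vandermonde':
  assumes "\<epsilon> \<le> 1"
  obtains w where "\<And>u. is_laurent_poly (w u)"
    "\<And>k m. n = k + Suc m \<Longrightarrow> i \<le> Suc m \<Longrightarrow>
      (\<Sum>v\<le>m. qbinom (Suc m - i) (m - v) * qbinom (n + k) v * w (Suc v))
        = q ^ (\<epsilon> * (k\<^sup>2 + k)) * qbinom (Suc m - i + (n + k)) m"
proof (cases "\<epsilon> = 0")
  case True
  show ?thesis
  proof (rule that[of "\<lambda>u. q ^ ((u - 1) * (u - i))"])
    fix k m assume "n = k + Suc m" "i \<le> Suc m"
    then show "(\<Sum>v\<le>m. qbinom (Suc m - i) (m - v) * qbinom (n + k) v * q ^ ((Suc v - 1) * (Suc v - i)))
        = q ^ (\<epsilon> * (k\<^sup>2 + k)) * qbinom (Suc m - i + (n + k)) m"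
      unfolding q_Vandermonde'[of "Suc m - i" "n + k" m] True
      by (auto intro!: sum.cong)
  qed simp
next
  case False
  then have e: "\<epsilon> = 1" using assms by simp
  show ?thesis
  proof (rule that[of "\<lambda>u. q ^ (n\<^sup>2 + n + u\<^sup>2) / q ^ (u * (2 * n + 1))"])
    fix k m assume n: "n = k + Suc m" and "i \<le> Suc m"
    have *: "q ^ (n\<^sup>2 + n + (Suc v)\<^sup>2) / q ^ (Suc v * (2 * n + 1)) = q ^ (k\<^sup>2 + k) * q ^ ((m - v) * (n + k - v))"
      if "v \<le> m" for v
      using q_power_weight[of k n "Suc v"] n that by simp
    show "(\<Sum>v\<le>m. qbinom (Suc m - i) (m - v) * qbinom (n + k) v *
          (q ^ (n\<^sup>2 + n + (Suc v)\<^sup>2) / q ^ (Suc v * (2 * n + 1))))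
        = q ^ (\<epsilon> * (k\<^sup>2 + k)) * qbinom (Suc m - i + (n + k)) m"
      unfolding q_Vandermonde[of "Suc m - i" "n + k" m] e sum_distrib_left
      by (rule sum.cong[OF refl]) (simp only: * atMost_iff, simp only: mult_ac mult_1)
  qed (intro laurent_divide_q_power laurent_q_power)
qed

text \<open>The factor \<open>qbinom (2 * n + 1) i\<close> is kept outside the sum because it later
  cancels the denominator \<open>1 - q ^ (2 * n + 1)\<close>.\<close>

lemma newton_basis_expansion:
  assumes "\<epsilon> \<le> 1"
  obtains w where "\<And>u. is_laurent_poly (w u)"
    "\<And>k. k \<le> n \<Longrightarrow> qbinom (2 * n + 1) (n - k) * q ^ (\<epsilon> * (k\<^sup>2 + k)) * newton_basis n i k
      = qbinom (2 * n + 1) i * (\<Sum>u\<le>n. w u * newton_basis n u k)"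
proof -
  obtain w where w: "\<And>u. is_laurent_poly (w u)"
    "\<And>k. k \<le> n \<Longrightarrow> i \<le> n - k \<Longrightarrow>
      (\<Sum>u\<le>n - k. qbinom (n - k - i) (n - k - u) * qbinom (n + k + 1) u * w u)
        = q ^ (\<epsilon> * (k\<^sup>2 + k)) * qbinom (n - k - i + (n + k + 1)) (n - k)"
    by (rule weighted_q_Vandermonde[OF assms, where n = n and i = i]) blast
  show ?thesis
  proof (rule that[of "\<lambda>u. qbinom u i * w u"])
    fix k assume k: "k \<le> n"
    show "qbinom (2 * n + 1) (n - k) * q ^ (\<epsilon> * (k\<^sup>2 + k)) * newton_basis n i k
      = qbinom (2 * n + 1) i * (\<Sum>u\<le>n. qbinom u i * w u * newton_basis n u k)"
    proof (cases "i \<le> n - k")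
      case True
      have "n - k + (n + k + 1) = 2 * n + 1" using k by simp
      then have "qbinom (2 * n + 1) (n - k) * q ^ (\<epsilon> * (k\<^sup>2 + k)) * newton_basis n i k
          = qbinom (2 * n + 1) i * (\<Sum>u\<le>n - k. qbinom u i * w u * newton_basis n u k)"
        using newton_basis_mult_qbinom[OF w(2)[OF k True] True] unfolding newton_basis_def by (simp only:)
      also have "(\<Sum>u\<le>n - k. qbinom u i * w u * newton_basis n u k) = (\<Sum>u\<le>n. qbinom u i * w u * newton_basis n u k)"
        by (rule sum.mono_neutral_left) (auto simp: newton_basis_eq_0)
      finally show ?thesis .
    next
      case False
      \<comment> \<open>For \<open>u < i\<close> the factor \<open>qbinom u i\<close> vanishes, and
        for \<open>u \<ge> i > n - k\<close> the basis element does.\<close>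
      then have "qbinom u i * w u * newton_basis n u k = 0" for u
        by (cases "u < i") (auto simp: newton_basis_eq_0)
      then have "(\<Sum>u\<le>n. qbinom u i * w u * newton_basis n u k) = 0" by (intro sum.neutral) blast
      then show ?thesis using False by (simp add: newton_basis_eq_0)
    qed
  qed (auto intro: laurent_mult w)
qed

lemma newton_span_qbinom_mult:
  assumes "\<epsilon> \<le> 1" "f \<in> newton_span n (\<lambda>_. 1)"
  shows "(\<lambda>k. qbinom (2 * n + 1) (n - k) * q ^ (\<epsilon> * (k\<^sup>2 + k)) * f k) \<in> newton_span n (\<lambda>_. 1)"
proof (rule newton_span_mult[OF assms(2)])
  fix i
  obtain w where "\<And>u. is_laurent_poly (w u)"
    "\<And>k. k \<le> n \<Longrightarrow> qbinom (2 * n + 1) (n - k) * q ^ (\<epsilon> * (k\<^sup>2 + k)) * newton_basis n i k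
      = qbinom (2 * n + 1) i * (\<Sum>u\<le>n. w u * newton_basis n u k)"
    by (rule newton_basis_expansion[OF assms(1), where n = n and i = i]) blast
  then show "(\<lambda>k. qbinom (2 * n + 1) (n - k) * q ^ (\<epsilon> * (k\<^sup>2 + k)) * (1 * newton_basis n i k)) \<in> newton_span n (\<lambda>_. 1)"
    by (intro newton_spanI[of "\<lambda>u. qbinom (2 * n + 1) i * w u"])
      (auto simp: sum_distrib_left mult.assoc intro: laurent_mult)
qed

text \<open>By absorption, \<open>1 - q ^ i\<close> times \<open>qbinom (2 * n + 1) i\<close> over
  \<open>1 - q ^ (2 * n + 1)\<close> is \<open>qbinom (2 * n) (i - 1)\<close>, or zero if
  \<open>i = 0\<close>. So the coefficients remain Laurent polynomials.\<close>

lemma newton_span_qbinom_mult_divide: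
  assumes "\<epsilon> \<le> 1" "f \<in> newton_span n (\<lambda>u. 1 - q ^ u)"
  shows "(\<lambda>k. qbinom (2 * n + 1) (n - k) / (1 - q ^ (2 * n + 1)) * q ^ (\<epsilon> * (k\<^sup>2 + k)) * f k) \<in> newton_span n (\<lambda>_. 1)"
proof (rule newton_span_mult[OF assms(2)])
  fix i
  obtain w where w: "\<And>u. is_laurent_poly (w u)"
    "\<And>k. k \<le> n \<Longrightarrow> qbinom (2 * n + 1) (n - k) * q ^ (\<epsilon> * (k\<^sup>2 + k)) * newton_basis n i k
      = qbinom (2 * n + 1) i * (\<Sum>u\<le>n. w u * newton_basis n u k)"
    by (rule newton_basis_expansion[OF assms(1), where n = n and i = i]) blast
  define c where "c = (1 - q ^ i) / (1 - q ^ (2 * n + 1)) * qbinom (2 * n + 1) i"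
  have c: "is_laurent_poly c"
  proof (cases i)
    case (Suc j)
    have "c = qbinom (2 * n) j"
      using qbinom_absorb[of "2 * n" j] one_minus_q_power_nonzero[of "Suc (2 * n)"]
      unfolding c_def Suc by (simp add: divide_simps mult.commute del: power_Suc)
    then show ?thesis by simp
  qed (simp add: c_def)
  show "(\<lambda>k. qbinom (2 * n + 1) (n - k) / (1 - q ^ (2 * n + 1)) * q ^ (\<epsilon> * (k\<^sup>2 + k)) *
      ((1 - q ^ i) * newton_basis n i k)) \<in> newton_span n (\<lambda>_. 1)"
  proof (rule newton_spanI[of "\<lambda>u. c * w u"])
    fix k assume "k \<le> n"
    have "qbinom (2 * n + 1) (n - k) / (1 - q ^ (2 * n + 1)) * q ^ (\<epsilon> * (k\<^sup>2 + k)) * ((1 - q ^ i) * newton_basis n i k)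
        = (1 - q ^ i) / (1 - q ^ (2 * n + 1)) * (qbinom (2 * n + 1) (n - k) * q ^ (\<epsilon> * (k\<^sup>2 + k)) * newton_basis n i k)"
      by (simp add: mult_ac)
    also have "\<dots> = c * (\<Sum>u\<le>n. w u * newton_basis n u k)"
      unfolding w(2)[OF \<open>k \<le> n\<close>] c_def by (simp only: mult.assoc)
    finally show "qbinom (2 * n + 1) (n - k) / (1 - q ^ (2 * n + 1)) * q ^ (\<epsilon> * (k\<^sup>2 + k)) * ((1 - q ^ i) * newton_basis n i k)
        = (\<Sum>u\<le>n. c * w u * (1 * newton_basis n u k))"
      by (simp add: sum_distrib_left mult.assoc)
  qed (auto intro: laurent_mult c w)
qed

text \<open>For \<open>k < n\<close>, absorption turns \<open>1 - q ^ (n - k)\<close>, the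
  denominator and \<open>qbinom (2 * n + 1) (n - k)\<close> into
  \<open>qbinom (2 * n) (n - k - 1)\<close>; then \<open>newton_basis_mult_qbinom'\<close>
  applies.\<close>

lemma newton_span_qbinom_mult_divide':
  assumes "\<epsilon> \<le> 1" "f \<in> newton_span n (\<lambda>_. 1)"
  shows "(\<lambda>k. (1 - q ^ (n - k)) * (1 - q ^ (n + k + 1)) / (1 - q ^ (2 * n + 1)) * qbinom (2 * n + 1) (n - k)
      * q ^ (\<epsilon> * (k\<^sup>2 + k)) * f k) \<in> newton_span n (\<lambda>u. 1 - q ^ u)"
proof (rule newton_span_mult[OF assms(2)])
  fix i
  obtain w where w: "\<And>u. is_laurent_poly (w u)"
    "\<And>k m. n = k + Suc m \<Longrightarrow> i \<le> Suc m \<Longrightarrow>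
      (\<Sum>v\<le>m. qbinom (Suc m - i) (m - v) * qbinom (n + k) v * w (Suc v))
        = q ^ (\<epsilon> * (k\<^sup>2 + k)) * qbinom (Suc m - i + (n + k)) m"
    by (rule weighted_q_Vandermonde'[OF assms(1), where n = n and i = i]) blast
  show "(\<lambda>k. (1 - q ^ (n - k)) * (1 - q ^ (n + k + 1)) / (1 - q ^ (2 * n + 1)) * qbinom (2 * n + 1) (n - k)
      * q ^ (\<epsilon> * (k\<^sup>2 + k)) * (1 * newton_basis n i k)) \<in> newton_span n (\<lambda>u. 1 - q ^ u)"
  proof (rule newton_spanI[of "\<lambda>u. qbinom (2 * n) i * (qbinom u i * w u)"])
    fix k assume "k \<le> n"
    let ?R = "\<lambda>u. qbinom u i * w u * ((1 - q ^ u) * newton_basis n u k)"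
    have "(1 - q ^ (n - k)) * (1 - q ^ (n + k + 1)) / (1 - q ^ (2 * n + 1)) * qbinom (2 * n + 1) (n - k)
          * q ^ (\<epsilon> * (k\<^sup>2 + k)) * newton_basis n i k = qbinom (2 * n) i * (\<Sum>u\<le>n. ?R u)"
    proof (cases "i \<le> n - k \<and> k < n")
      case True
      then obtain m where n: "n = k + Suc m" using less_iff_Suc_add by auto
      have i: "n - k = Suc m" "m + Suc (n + k) = 2 * n" using n by simp_all
      have *: "qbinom (2 * n) m = (1 - q ^ (n - k)) / (1 - q ^ (2 * n + 1)) * qbinom (2 * n + 1) (n - k)"
        using qbinom_absorb[of "2 * n" m] one_minus_q_power_nonzero[of "Suc (2 * n)"]
        unfolding i by (simp add: divide_simps mult.commute del: power_Suc)
      have "(1 - q ^ (n - k)) * (1 - q ^ (n + k + 1)) / (1 - q ^ (2 * n + 1)) * qbinom (2 * n + 1) (n - k)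
          * q ^ (\<epsilon> * (k\<^sup>2 + k)) * newton_basis n i k
          = (1 - q ^ Suc (n + k)) * qbinom (m + Suc (n + k)) m * q ^ (\<epsilon> * (k\<^sup>2 + k)) *
              (qbinom (Suc m) i * qbinom (Suc (n + k)) i)"
        unfolding i(2) * unfolding newton_basis_def i(1)
        by (simp only: times_divide_eq_left times_divide_eq_right mult_ac Suc_eq_plus1)
      also have "\<dots> = qbinom (2 * n) i * (\<Sum>u\<le>n - k. ?R u)"
        using newton_basis_mult_qbinom'[OF w(2)[OF n]] True unfolding newton_basis_def i by simp
      also have "(\<Sum>u\<le>n - k. ?R u) = (\<Sum>u\<le>n. ?R u)"
        by (rule sum.mono_neutral_left) (auto simp: newton_basis_eq_0)
      finally show ?thesis .
    next
      case False
      then have *: "k = n \<or> n - k < i" using \<open>k \<le> n\<close> by auto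
      \<comment> \<open>If \<open>k = n\<close>, the term \<open>u = 0\<close> has the factor
        \<open>1 - q ^ 0 = 0\<close> and all others have a vanishing basis element. If
        \<open>n - k < i\<close>, either \<open>u < i\<close> or \<open>n - k < u\<close>.\<close>
      have "?R u = 0" for u
        using * by (cases "u = 0"; cases "u < i") (auto simp: newton_basis_eq_0)
      then have "(\<Sum>u\<le>n. ?R u) = 0" by (intro sum.neutral) blast
      then show ?thesis using * by (auto simp: newton_basis_eq_0)
    qed
    then show "(1 - q ^ (n - k)) * (1 - q ^ (n + k + 1)) / (1 - q ^ (2 * n + 1)) * qbinom (2 * n + 1) (n - k)
          * q ^ (\<epsilon> * (k\<^sup>2 + k)) * (1 * newton_basis n i k)
        = (\<Sum>u\<le>n. qbinom (2 * n) i * (qbinom u i * w u) * ((1 - q ^ u) * newton_basis n u k))"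
      by (simp add: sum_distrib_left mult.assoc)
  qed (intro laurent_mult laurent_qbinom w(1))
qed

section \<open>Stability of the span under even powers of \<open>A\<close>\<close>

text \<open>This includes \<open>i > n\<close>, where the function vanishes on
  \<open>{0..n}\<close>; \<open>newton_span_raise\<close> reaches the index
  \<open>n + 1\<close>.\<close>

lemma newton_basis_in_span: "newton_basis n i \<in> newton_span n (\<lambda>_. 1)"
proof (rule newton_spanI[of "\<lambda>u. if u = i then 1 else 0"])
  fix k assume "k \<le> n"
  have "(\<Sum>u\<le>n. (if u = i then 1 else 0) * (1 * newton_basis n u k))
      = (\<Sum>u\<le>n. if u = i then newton_basis n i k else 0)"
    by (rule sum.cong) auto
  then show "newton_basis n i k = (\<Sum>u\<le>n. (if u = i then 1 else 0) * (1 * newton_basis n u k))"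
    by (auto simp: newton_basis_eq_0)
qed auto

lemma qbinom_raise: "(1 - q ^ p) * qbinom (i + p) i = (1 - q ^ Suc i) * qbinom (i + p) (Suc i)"
proof (cases p)
  case (Suc p')
  have "qbinom (i + p) (Suc i) = qpoch (i + p) / (qpoch i * (1 - q ^ Suc i) * qpoch p')"
    using qbinom_add[of "Suc i" p'] by (simp add: Suc qpoch_Suc del: power_Suc)
  moreover have "qbinom (i + p) i = qpoch (i + p) / (qpoch i * (qpoch p' * (1 - q ^ p)))"
    unfolding qbinom_add by (simp only: Suc qpoch_Suc)
  ultimately show ?thesis
    using one_minus_q_power_nonzero[of "Suc i"] one_minus_q_power_nonzero[of p] Suc
    by (simp del: power_Suc)
qed simp

text \<open>The multiplier is linear in q^(n-k) + q^(n+k+1), so it sends the basis element of index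
  \<open>i\<close> to a combination of those of index \<open>i\<close> and \<open>i + 1\<close>.
  With x = q^i, y = q^(n-k-i) and z = q^(n+k+1-i) this is the identity (1-xy)(1-xz) = x(1-y)(1-z) +
  (1-x)(1-xyz).\<close>

lemma newton_span_raise:
  assumes "f \<in> newton_span n (\<lambda>_. 1)"
  shows "(\<lambda>k. (1 - q ^ (n - k)) * (1 - q ^ (n + k + 1)) * f k) \<in> newton_span n (\<lambda>_. 1)"
proof (rule newton_span_mult[OF assms])
  fix i
  define c d where "c = q ^ i * (1 - q ^ Suc i)\<^sup>2" and "d = (1 - q ^ i) * (1 - q ^ (2 * n + 1 - i))"
  have "(\<lambda>k. c * newton_basis n (Suc i) k + d * newton_basis n i k) \<in> newton_span n (\<lambda>_. 1)"
    unfolding c_def d_def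
    by (intro newton_span_add newton_span_scale newton_basis_in_span laurent_mult laurent_power laurent_diff
        laurent_q_power laurent_1)
  then show "(\<lambda>k. (1 - q ^ (n - k)) * (1 - q ^ (n + k + 1)) * (1 * newton_basis n i k)) \<in> newton_span n (\<lambda>_. 1)"
  proof (rule newton_span_cong)
    fix k assume "k \<le> n"
    show "c * newton_basis n (Suc i) k + d * newton_basis n i k
        = (1 - q ^ (n - k)) * (1 - q ^ (n + k + 1)) * (1 * newton_basis n i k)"
    proof (cases "i \<le> n - k")
      case True
      then obtain p where p: "n - k = i + p" using le_Suc_ex by blast
      then have P: "n + k + 1 = i + (p + 2 * k + 1)" and N: "2 * n + 1 - i = i + p + (p + 2 * k + 1)"
        using \<open>k \<le> n\<close> by simp_all
      define P where "P = p + 2 * k + 1"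
      define x y z where "x = q ^ i" and "y = q ^ p" and "z = q ^ P"
      define s t where "s = qbinom (i + p) i" and "t = qbinom (i + P) i"
      have "c * newton_basis n (Suc i) k
          = x * ((1 - q ^ Suc i) * qbinom (i + p) (Suc i)) * ((1 - q ^ Suc i) * qbinom (i + P) (Suc i))"
        unfolding c_def newton_basis_def p P P_def x_def power2_eq_square by (simp only: mult_ac)
      also have "\<dots> = x * ((1 - y) * s) * ((1 - z) * t)"
        unfolding qbinom_raise[symmetric] y_def z_def s_def t_def ..
      finally have 1: "c * newton_basis n (Suc i) k = x * ((1 - y) * s) * ((1 - z) * t)" .
      have 2: "d * newton_basis n i k = (1 - x) * (1 - x * y * z) * (s * t)"
        unfolding d_def newton_basis_def p N unfolding P x_def y_def z_def s_def t_def P_def power_add ..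
      have 3: "(1 - q ^ (n - k)) * (1 - q ^ (n + k + 1)) * (1 * newton_basis n i k)
          = (1 - x * y) * (1 - x * z) * (s * t)"
        unfolding newton_basis_def p P unfolding P_def[symmetric] power_add
        by (simp add: x_def y_def z_def s_def t_def)
      show ?thesis unfolding 1 2 3 by (simp add: algebra_simps)
    qed (simp add: newton_basis_eq_0)
  qed
qed

text \<open>Put a = q^(n-k) and b = q^(n+k+1), so that ab = z, Y = 1+z-(a+b) and
  \<open>A n k\<close> is (a-b)B/(1-z). Then (a-b)^2 = (1+z-Y)^2 - 4z = (1-z)^2 +
  Y(Y-2(1+z)).\<close>

lemma A_power2:
  assumes "k \<le> n"
  defines "B \<equiv> qbinom (2 * n + 1) (n - k)" and "Y \<equiv> (1 - q ^ (n - k)) * (1 - q ^ (n + k + 1))"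
    and "z \<equiv> q ^ (2 * n + 1)"
  shows "(A n k)\<^sup>2 = B\<^sup>2 + B / (1 - z) * (Y / (1 - z) * B * (Y - 2 * (1 + z)))"
proof -
  define x w where "x = q ^ (n - k)" and "w = q ^ (2 * k + 1)"
  have nz: "1 - z \<noteq> 0" "1 - q \<noteq> 0"
    using one_minus_q_power_nonzero[of "2 * n + 1"] one_minus_q_power_nonzero[of 1] by (simp_all add: z_def)
  have "n + k + 1 = n - k + (2 * k + 1)" "2 * n + 1 = n - k + (n - k + (2 * k + 1))" using assms(1) by simp_all
  then have e: "q ^ (n + k + 1) = x * w" "z = x * (x * w)"
    unfolding x_def w_def z_def power_add[symmetric] by (simp_all only:)
  have "A n k = x * (1 - w) / (1 - z) * B"
    using nz by (simp add: A_def qint_def B_def z_def w_def x_def)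
  then have "(A n k)\<^sup>2 = (x - x * w)\<^sup>2 * B\<^sup>2 / (1 - z)\<^sup>2"
    by (simp add: power_mult_distrib power_divide right_diff_distrib)
  also have "(x - x * w)\<^sup>2 = (1 - z)\<^sup>2 + Y * (Y - 2 * (1 + z))"
    unfolding Y_def e by (simp add: x_def power2_eq_square algebra_simps)
  also have "\<dots> * B\<^sup>2 / (1 - z)\<^sup>2 = B\<^sup>2 + B / (1 - z) * (Y / (1 - z) * B * (Y - 2 * (1 + z)))"
  proof -
    have "(c\<^sup>2 + Y * t) * B\<^sup>2 / c\<^sup>2 = B\<^sup>2 + B / c * (Y / c * B * t)" if "c \<noteq> 0" for c t
      using that by (simp add: divide_simps) (simp add: power2_eq_square algebra_simps)
    then show ?thesis using nz(1) by blast
  qed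
  finally show ?thesis .
qed

lemma newton_span_A_power2:
  assumes "e \<le> 2" "f \<in> newton_span n (\<lambda>_. 1)"
  shows "(\<lambda>k. (A n k)\<^sup>2 * q ^ (e * (k\<^sup>2 + k)) * f k) \<in> newton_span n (\<lambda>_. 1)"
proof -
  \<comment> \<open>The weight is split between the two factors \<open>B\<close> of the square, each
    of which can carry an exponent of at most one.\<close>
  define s t where "s = min e 1" and "t = e - s"
  have st: "s \<le> 1" "t \<le> 1" "e = s + t" using assms(1) by (auto simp: s_def t_def)
  define B where "B k = qbinom (2 * n + 1) (n - k)" for k
  define Y where "Y k = (1 - q ^ (n - k)) * (1 - q ^ (n + k + 1))" for k
  define h where "h s k = q ^ (s * (k\<^sup>2 + k))" for s k
  define z where "z = q ^ (2 * n + 1)"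
  have 1: "(\<lambda>k. B k * h s k * (B k * h t k * f k)) \<in> newton_span n (\<lambda>_. 1)"
    unfolding B_def h_def by (intro newton_span_qbinom_mult st assms)
  have "(\<lambda>k. Y k * f k + - 2 * (1 + z) * f k) \<in> newton_span n (\<lambda>_. 1)"
    unfolding Y_def z_def
    using assms(2) laurent_minus[OF laurent_add[OF laurent_1 laurent_1]]
    by (intro newton_span_add newton_span_raise newton_span_scale laurent_mult laurent_add laurent_q_power) auto
  \<comment> \<open>The order matters: this multiplication produces the factors
    \<open>1 - q ^ u\<close> that the next one, by \<open>B k / (1 - z)\<close>, uses up.\<close>
  then have "(\<lambda>k. Y k / (1 - z) * B k * h t k * (Y k * f k + - 2 * (1 + z) * f k)) \<in> newton_span n (\<lambda>u. 1 - q ^ u)"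
    unfolding B_def h_def Y_def z_def by (rule newton_span_qbinom_mult_divide'[OF st(2)])
  then have "(\<lambda>k. B k / (1 - z) * h s k * (Y k / (1 - z) * B k * h t k * (Y k * f k + - 2 * (1 + z) * f k)))
      \<in> newton_span n (\<lambda>_. 1)"
    unfolding B_def h_def z_def by (rule newton_span_qbinom_mult_divide[OF st(1)])
  from newton_span_add[OF 1 this] show ?thesis
  proof (rule newton_span_cong)
    fix k assume "k \<le> n"
    have h: "q ^ (e * (k\<^sup>2 + k)) = h s k * h t k"
      unfolding h_def st(3) by (simp add: power_add distrib_right)
    have "Y k * f k + - 2 * (1 + z) * f k = (Y k - 2 * (1 + z)) * f k" by (simp add: algebra_simps)
    then show "B k * h s k * (B k * h t k * f k)
        + B k / (1 - z) * h s k * (Y k / (1 - z) * B k * h t k * (Y k * f k + - 2 * (1 + z) * f k))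
        = (A n k)\<^sup>2 * q ^ (e * (k\<^sup>2 + k)) * f k"
      unfolding A_power2[OF \<open>k \<le> n\<close>, folded B_def Y_def z_def] h power2_eq_square[of "B k"] distrib_right
      by (simp only: mult_ac)
  qed
qed

lemma A_even_power_in_newton_span:
  "j \<le> 2 * r \<Longrightarrow> (\<lambda>k. A n k ^ (2 * r) * q ^ (j * (k\<^sup>2 + k))) \<in> newton_span n (\<lambda>_. 1)"
proof (induction r arbitrary: j)
  case 0
  \<comment> \<open>For \<open>r = 0\<close> the function is the constant 1, which is
    \<open>newton_basis n 0\<close>.\<close>
  then show ?case
    using newton_basis_in_span[of n 0] by (auto intro: newton_span_cong simp: newton_basis_def)
next
  case (Suc r)
  \<comment> \<open>Each squared factor takes up to two units of the weight, leaving at most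
    \<open>2 * r\<close> for the induction hypothesis.\<close>
  define e where "e = min j 2"
  have e: "e \<le> 2" "j - e \<le> 2 * r" "j = e + (j - e)" using Suc.prems by (auto simp: e_def)
  have "(\<lambda>k. (A n k)\<^sup>2 * q ^ (e * (k\<^sup>2 + k)) * (A n k ^ (2 * r) * q ^ ((j - e) * (k\<^sup>2 + k))))
      \<in> newton_span n (\<lambda>_. 1)"
    by (intro newton_span_A_power2 Suc.IH e)
  then show ?case
  proof (rule newton_span_cong)
    fix k
    have "q ^ (j * (k\<^sup>2 + k)) = q ^ (e * (k\<^sup>2 + k)) * q ^ ((j - e) * (k\<^sup>2 + k))"
      by (subst e(3)) (simp only: distrib_right power_add)
    moreover have "A n k ^ (2 * Suc r) = (A n k)\<^sup>2 * A n k ^ (2 * r)"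
      by (simp add: power2_eq_square)
    ultimately show "(A n k)\<^sup>2 * q ^ (e * (k\<^sup>2 + k)) * (A n k ^ (2 * r) * q ^ ((j - e) * (k\<^sup>2 + k)))
        = A n k ^ (2 * Suc r) * q ^ (j * (k\<^sup>2 + k))" by (simp only: mult_ac)
  qed
qed

section \<open>Telescoping sums and the congruence\<close>

text \<open>\<open>U\<close> is an antidifference of the summand up to a power of \<open>q\<close>.
  Its value 0 beyond \<open>n\<close> is essential at \<open>k = n\<close>, where
  \<open>n - Suc k\<close> would truncate to 0 and give a nonzero value for
  \<open>s = 0\<close>.\<close>

lemma A_mult_newton_basis:
  fixes s :: nat
  assumes "k \<le> n" "\<epsilon> \<le> 1"
  defines "U \<equiv> \<lambda>k. if k \<le> n then q ^ (\<epsilon> * k\<^sup>2) * (qbinom (2 * n) (n - k) * (qbinom (n - k) s * qbinom (n + k) s)) else 0"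
  shows "A n k * q ^ (\<epsilon> * (k\<^sup>2 + k)) * newton_basis n s k
      = q ^ (if \<epsilon> = 0 then s else n) * (U k - U (Suc k))"
proof (cases "s \<le> n - k")
  case False
  then show ?thesis by (simp add: newton_basis_eq_0 U_def)
next
  case True
  then obtain p where p: "n - k = s + p" using le_Suc_ex by blast
  then have n: "n = k + s + p" using assms(1) by simp
  define P where "P = p + 2 * k"
  define S G H F where "S = qpoch s" and "G = qpoch p" and "H = qpoch P" and "F = qpoch (2 * n)"
  define x y w where "x = q ^ p" and "y = q ^ Suc P" and "w = q ^ (2 * k + 1)"
  have nz: "1 - y \<noteq> 0" "1 - q ^ (2 * n + 1) \<noteq> 0" "1 - q \<noteq> 0" "S \<noteq> 0" "G \<noteq> 0" "H \<noteq> 0" "F \<noteq> 0"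
    using one_minus_q_power_nonzero[of "Suc P"] one_minus_q_power_nonzero[of "2 * n + 1"]
      one_minus_q_power_nonzero[of 1]
    by (auto simp: y_def S_def G_def H_def F_def qpoch_nonzero)
  have y: "y = x * w" unfolding y_def x_def w_def P_def power_add[symmetric] by simp
  \<comment> \<open>\<open>b\<close> is \<open>U k\<close> without its power of \<open>q\<close>;
    the step to \<open>U (Suc k)\<close> multiplies it by \<open>(1 - x) / (1 - y)\<close>.\<close>
  define b where "b = F / (S * S * G * H)"
  have b: "S * S * G * H * b = F" using nz by (simp add: b_def)
  have U0: "U k = q ^ (\<epsilon> * k\<^sup>2) * b"
  proof -
    have i: "2 * n = (s + p) + (s + P)" "n + k = s + P" using n by (simp_all add: P_def)
    have "qbinom (2 * n) (n - k) = F / (qpoch (s + p) * qpoch (s + P))"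
      using qbinom_add[of "s + p" "s + P"] unfolding p F_def i(1) .
    then show ?thesis using assms(1) nz
      unfolding U_def p i(2) qbinom_add b_def S_def G_def H_def
      by (simp add: qpoch_nonzero mult_ac)
  qed
  have U1: "U (Suc k) = q ^ (\<epsilon> * (Suc k)\<^sup>2) * (b * (1 - x) / (1 - y))"
  \<comment> \<open>If \<open>p = 0\<close>, then \<open>1 - x = 0\<close>, and
    \<open>U (Suc k)\<close> is zero as well: either \<open>Suc k > n\<close> or
    \<open>n - Suc k < s\<close>.\<close>
  proof (cases p)
    case 0
    then show ?thesis using n by (auto simp: U_def x_def)
  next
    case (Suc p')
    have i: "n - Suc k = s + p'" "n + Suc k = s + Suc P" "2 * n = (s + p') + (s + Suc P)" "Suc k \<le> n"
      using n Suc by (simp_all add: P_def)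
    have "qbinom (2 * n) (n - Suc k) = F / (qpoch (s + p') * qpoch (s + Suc P))"
      using qbinom_add[of "s + p'" "s + Suc P"] unfolding i(1) F_def i(3) .
    moreover have "G = qpoch p' * (1 - x)" "qpoch (Suc P) = H * (1 - y)"
      unfolding G_def x_def y_def H_def Suc qpoch_Suc by (rule refl)+
    moreover have "1 - x \<noteq> 0" using one_minus_q_power_nonzero[of p] Suc by (simp add: x_def)
    ultimately show ?thesis using nz i(4)
      unfolding U_def i(1,2) qbinom_add b_def S_def
      by (simp add: qpoch_nonzero mult_ac)
  qed
  have L: "A n k * newton_basis n s k = q ^ s * x * (1 - w) * b / (1 - y)"
  proof -
    have i: "2 * n + 1 = (s + p) + (s + Suc P)" "n + k + 1 = s + Suc P" using n by (simp_all add: P_def)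
    have "qpoch (2 * n + 1) = F * (1 - q ^ (2 * n + 1))" by (simp add: qpoch_Suc F_def)
    then have "qbinom (2 * n + 1) (n - k) = F * (1 - q ^ (2 * n + 1)) / (qpoch (s + p) * qpoch (s + Suc P))"
      using qbinom_add[of "s + p" "s + Suc P"] unfolding p i(1)[symmetric] by simp
    moreover have "A n k = q ^ s * x * (1 - w) / (1 - q ^ (2 * n + 1)) * qbinom (2 * n + 1) (n - k)"
      using nz by (simp add: A_def qint_def p x_def w_def power_add)
    moreover have "newton_basis n s k = qpoch (s + p) / (S * G) * (qpoch (s + Suc P) / (S * (H * (1 - y))))"
      unfolding newton_basis_def p i(2) qbinom_add S_def G_def H_def y_def qpoch_Suc ..
    ultimately show ?thesis
      using nz qpoch_nonzero[of "s + p"] qpoch_nonzero[of "s + Suc P"] unfolding b_def by (simp add: mult_ac)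
  qed
  have "A n k * q ^ (\<epsilon> * (k\<^sup>2 + k)) * newton_basis n s k
      = q ^ (\<epsilon> * (k\<^sup>2 + k)) * (q ^ s * x * (1 - w) * b / (1 - y))"
    unfolding L[symmetric] by (simp only: mult_ac)
  also have "\<dots> = q ^ (if \<epsilon> = 0 then s else n) * (U k - U (Suc k))"
  proof (cases "\<epsilon> = 0")
    case True
    have "b - b * (1 - x) / (1 - y) = b * ((1 - y) - (1 - x)) / (1 - y)"
      using nz by (simp add: field_simps)
    also have "(1 - y) - (1 - x) = x * (1 - w)" by (simp add: y right_diff_distrib)
    finally show ?thesis unfolding U0 U1 True by (simp add: mult_ac)
  next
    case False
    then have e: "\<epsilon> = 1" using assms(2) by simp
    have "(Suc k)\<^sup>2 = k\<^sup>2 + (2 * k + 1)" by (simp add: power2_eq_square)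
    then have k: "q ^ (Suc k)\<^sup>2 = q ^ k\<^sup>2 * w" unfolding w_def by (simp only: power_add)
    have "U k - U (Suc k) = q ^ k\<^sup>2 * b * ((1 - y) - w * (1 - x)) / (1 - y)"
      unfolding U0 U1 e mult_1 k using nz by (simp add: field_simps)
    also have "(1 - y) - w * (1 - x) = 1 - w" by (simp add: y algebra_simps)
    finally show ?thesis unfolding e mult_1 n x_def by (simp add: power_add mult_ac)
  qed
  finally show ?thesis .
qed

text \<open>The upper end contributes \<open>U (Suc n) = 0\<close>, so only \<open>U a\<close>
  survives, and it contains the modulus \<open>qbinom (2 * n) (n - a)\<close> as a factor.\<close>

lemma sum_A_newton_basis:
  assumes "a \<le> n" "\<epsilon> \<le> 1"
  shows "(\<Sum>k = a..n. A n k * q ^ (\<epsilon> * (k\<^sup>2 + k)) * newton_basis n s k)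
      = q ^ (if \<epsilon> = 0 then s else n) * q ^ (\<epsilon> * a\<^sup>2) * qbinom (n - a) s * qbinom (n + a) s * qbinom (2 * n) (n - a)"
proof -
  define U where
    "U = (\<lambda>k. if k \<le> n then q ^ (\<epsilon> * k\<^sup>2) * (qbinom (2 * n) (n - k) * (qbinom (n - k) s * qbinom (n + k) s)) else 0)"
  have "(\<Sum>k = a..n. A n k * q ^ (\<epsilon> * (k\<^sup>2 + k)) * newton_basis n s k)
      = (\<Sum>k = a..n. q ^ (if \<epsilon> = 0 then s else n) * (U k - U (Suc k)))"
    unfolding U_def by (intro sum.cong A_mult_newton_basis assms(2)) auto
  also have "\<dots> = q ^ (if \<epsilon> = 0 then s else n) * - (\<Sum>k = a..n. U (Suc k) - U k)"
    by (simp only: sum_distrib_left[symmetric] sum_negf[symmetric] minus_diff_eq)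
  also have "(\<Sum>k = a..n. U (Suc k) - U k) = - U a"
    using sum_Suc_diff[of a n U] assms(1) by (simp add: U_def)
  finally show ?thesis using assms(1) by (simp add: U_def mult_ac)
qed

theorem theorem1p6:
  fixes n a r j :: nat
  assumes "n > 0"
    and "a \<le> n"
    and "j \<le> 2 * r + 1"
  shows "laurent_cong_0
           (\<Sum>k = a..n. A n k ^ (2 * r + 1) * q ^ (j * (k\<^sup>2 + k)))
           (qbinom (2 * n) (n - a))"
proof -
  \<comment> \<open>Truncated subtraction makes this 1 for \<open>j = 2 * r + 1\<close> and 0
    otherwise. This part of the weight stays with the single factor \<open>A n k\<close>; the even
    power carries the rest.\<close>
  define \<epsilon> where "\<epsilon> = j - 2 * r"
  have \<epsilon>: "\<epsilon> \<le> 1" "j - \<epsilon> \<le> 2 * r" "j = \<epsilon> + (j - \<epsilon>)" using assms(3) by (auto simp: \<epsilon>_def)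
  obtain d where d: "\<And>u. is_laurent_poly (d u)"
    "\<And>k. k \<le> n \<Longrightarrow> A n k ^ (2 * r) * q ^ ((j - \<epsilon>) * (k\<^sup>2 + k)) = (\<Sum>u\<le>n. d u * (1 * newton_basis n u k))"
    using A_even_power_in_newton_span[OF \<epsilon>(2), of n] unfolding newton_span_def by blast
  \<comment> \<open>\<open>c u\<close> is the cofactor of the modulus in the contribution of index
    \<open>u\<close>, read off from \<open>sum_A_newton_basis\<close>.\<close>
  define c where "c u = d u * (q ^ (if \<epsilon> = 0 then u else n) * q ^ (\<epsilon> * a\<^sup>2) * qbinom (n - a) u * qbinom (n + a) u)" for u
  have "(\<Sum>k = a..n. A n k ^ (2 * r + 1) * q ^ (j * (k\<^sup>2 + k)))
      = (\<Sum>k = a..n. \<Sum>u\<le>n. d u * (A n k * q ^ (\<epsilon> * (k\<^sup>2 + k)) * newton_basis n u k))"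
  proof (rule sum.cong[OF refl])
    fix k assume "k \<in> {a..n}"
    have "q ^ (j * (k\<^sup>2 + k)) = q ^ (\<epsilon> * (k\<^sup>2 + k)) * q ^ ((j - \<epsilon>) * (k\<^sup>2 + k))"
      by (subst \<epsilon>(3)) (simp only: distrib_right power_add)
    then have "A n k ^ (2 * r + 1) * q ^ (j * (k\<^sup>2 + k))
        = A n k * q ^ (\<epsilon> * (k\<^sup>2 + k)) * (A n k ^ (2 * r) * q ^ ((j - \<epsilon>) * (k\<^sup>2 + k)))"
      by (simp add: mult_ac)
    also have "\<dots> = (\<Sum>u\<le>n. d u * (A n k * q ^ (\<epsilon> * (k\<^sup>2 + k)) * newton_basis n u k))"
    proof -
      have *: "A n k ^ (2 * r) * q ^ ((j - \<epsilon>) * (k\<^sup>2 + k)) = (\<Sum>u\<le>n. d u * (1 * newton_basis n u k))"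
        using \<open>k \<in> {a..n}\<close> by (intro d(2)) simp
      show ?thesis unfolding * sum_distrib_left by (simp add: mult_ac)
    qed
    finally show "A n k ^ (2 * r + 1) * q ^ (j * (k\<^sup>2 + k))
        = (\<Sum>u\<le>n. d u * (A n k * q ^ (\<epsilon> * (k\<^sup>2 + k)) * newton_basis n u k))" .
  qed
  also have "\<dots> = (\<Sum>u\<le>n. d u * (\<Sum>k = a..n. A n k * q ^ (\<epsilon> * (k\<^sup>2 + k)) * newton_basis n u k))"
    by (subst sum.swap) (simp add: sum_distrib_left)
  also have "\<dots> = (\<Sum>u\<le>n. c u) * qbinom (2 * n) (n - a)"
    unfolding sum_A_newton_basis[OF assms(2) \<epsilon>(1)] c_def sum_distrib_right by (simp only: mult.assoc)
  finally have "(\<Sum>k = a..n. A n k ^ (2 * r + 1) * q ^ (j * (k\<^sup>2 + k))) / qbinom (2 * n) (n - a) = (\<Sum>u\<le>n. c u)"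
    using qbinom_nonzero[of "n - a" "2 * n"] by simp
  then show ?thesis
    unfolding laurent_cong_0_def c_def by (auto intro!: laurent_sum laurent_mult d(1))
qed

end
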